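(* Let $p$ be an odd prime, $\alpha$ a positive integer, and $k\geq 3$ an odd integer. Let $S_k(n):=1^k+2^k+\cdots+n^k$. If $p-1\nmid (k-1)$, then \[ (p^\alpha)^2 \mid S_k(p^\alpha). \] *)

theory Defs
  imports "HOL-Number_Theory.Number_Theory"
begin

definition S :: "nat \<Rightarrow> nat \<Rightarrow> nat" where
  "S k n = (\<Sum>i=1..n. i ^ k)"

end

theory Submission
  imports Defs
begin

text \<open>
  Write $n = p^\alpha$. Pairing $i$ with $n - i$ and expanding $(n - i)^k$ modulo $n^2$ gives
  $2 S_k(n) \equiv k n \sum_{i<n} i^{k-1}$ modulo $n^2$, as $k$ is odd. Multiplication by a primitive
  root $g$ of $p$ permutes the residues modulo $n$, so $n$ divides
  $(g^{k-1} - 1) \sum_{i<n} i^{k-1}$, and $g^{k-1} - 1$ is coprime to $p$.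
\<close>

text \<open>This is the binomial expansion cut after its linear term. The integers are used so that
  \<open>x\<close> may be negative, and \<open>Suc m\<close> avoids a truncated exponent
  \<open>m - 1\<close>.\<close>

lemma power_add_cong_square:
  fixes x y :: int
  shows "[(x + y) ^ Suc m = x ^ Suc m + int (Suc m) * x ^ m * y] (mod y\<^sup>2)"
proof (induction m)
  case 0
  show ?case by simp
next
  case (Suc m)
  have "[(x + y) ^ Suc (Suc m) = (x + y) * (x ^ Suc m + int (Suc m) * x ^ m * y)] (mod y\<^sup>2)"
    using cong_mult[OF cong_refl Suc.IH, of "x + y"] by simp
  also have "(x + y) * (x ^ Suc m + int (Suc m) * x ^ m * y) =
      x ^ Suc (Suc m) + int (Suc (Suc m)) * x ^ Suc m * y + y\<^sup>2 * (int (Suc m) * x ^ m)"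
    by (simp add: algebra_simps power2_eq_square)
  also have "[\<dots> = x ^ Suc (Suc m) + int (Suc (Suc m)) * x ^ Suc m * y] (mod y\<^sup>2)"
    by (simp add: cong_iff_dvd_diff)
  finally show ?case .
qed

text \<open>A unit \<open>g\<close> modulo \<open>n\<close> can be cancelled, which gives
  injectivity; multiplying by its inverse \<open>h\<close> gives preimages.\<close>

lemma bij_betw_mult_mod:
  fixes g n :: nat
  assumes "coprime g n" and "n > 0"
  shows "bij_betw (\<lambda>i. g * i mod n) {..<n} {..<n}"
proof (rule bij_betwI')
  fix i j assume "i \<in> {..<n}" "j \<in> {..<n}"
  then show "g * i mod n = g * j mod n \<longleftrightarrow> i = j"
    using assms cong_mult_lcancel_nat[of g n i j] by (auto simp: cong_def)
next
  fix i show "g * i mod n \<in> {..<n}" using assms by simp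
next
  fix j assume j: "j \<in> {..<n}"
  obtain h where "[g * h = 1] (mod n)"
    using cong_solve_coprime_nat[OF assms(1)] by auto
  then have "[g * h * j = j] (mod n)"
    using cong_mult[OF _ cong_refl, of "g * h" 1 n j] by simp
  then have "j = g * (h * j mod n) mod n"
    using j by (simp add: cong_def mod_mult_right_eq mult.assoc)
  then show "\<exists>i\<in>{..<n}. j = g * i mod n"
    using assms by (intro bexI[of _ "h * j mod n"]) auto
qed

lemma prime_power_dvd_sum_powers:
  fixes p :: nat
  assumes "prime p" and "\<not> (p - 1) dvd m"
  shows "p ^ a dvd (\<Sum>i<p ^ a. i ^ m)"
proof -
  define n where "n = p ^ a"
  have n: "n > 0" using assms by (simp add: n_def prime_gt_0_nat)
  obtain g where "residue_primroot p g"
    using prime_primitive_root_exists assms(1) prime_gt_1_nat by metis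
  then have g: "coprime g p" and ord: "ord p g = p - 1"
    using assms(1) by (auto simp: residue_primroot_def totient_prime coprime_commute)
  have "\<not> [g ^ m = 1] (mod p)"
    using assms(2) ord by (simp add: ord_divides')
  \<comment> \<open>The passage to integers makes the subtraction exact. Being prime to
    \<open>p\<close>, the difference is then prime to every power of \<open>p\<close>.\<close>
  then have "\<not> int p dvd int (g ^ m) - 1"
    by (metis cong_iff_dvd_diff cong_int_iff of_nat_1)
  then have cop: "coprime (int n) (int (g ^ m) - 1)"
    unfolding n_def using assms(1) by (simp add: prime_imp_coprime)
  \<comment> \<open>A primitive root modulo \<open>p\<close> suffices: to permute the residues
    modulo \<open>n\<close>, \<open>g\<close> only has to be a unit there.\<close>
  have "coprime g n" using g by (simp add: n_def)
  then have "(\<Sum>i<n. (g * i mod n) ^ m) = (\<Sum>i<n. i ^ m)"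
    using sum.reindex_bij_betw[OF bij_betw_mult_mod[OF _ n], of g "\<lambda>i. i ^ m"] by simp
  moreover have "[(\<Sum>i<n. (g * i mod n) ^ m) = (\<Sum>i<n. (g * i) ^ m)] (mod n)"
    by (intro cong_sum cong_pow) (simp add: cong_def)
  ultimately have "[g ^ m * (\<Sum>i<n. i ^ m) = (\<Sum>i<n. i ^ m)] (mod n)"
    by (simp add: power_mult_distrib sum_distrib_left cong_sym)
  then have "[int (g ^ m * (\<Sum>i<n. i ^ m)) = int (\<Sum>i<n. i ^ m)] (mod int n)"
    by (simp only: cong_int_iff)
  then have "int n dvd (int (g ^ m) - 1) * int (\<Sum>i<n. i ^ m)"
    by (simp only: cong_iff_dvd_diff of_nat_mult left_diff_distrib mult_1)
  then have "int n dvd int (\<Sum>i<n. i ^ m)"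
    using cop coprime_dvd_mult_right_iff by blast
  then show ?thesis
    by (simp only: n_def int_dvd_int_iff)
qed

theorem theorem3p3:
  fixes p \<alpha> k :: nat
  assumes "prime p" and "odd p"
    and "\<alpha> > 0"
    and "k \<ge> 3" and "odd k"
    and "\<not> (p - 1) dvd (k - 1)"
  shows "(p ^ \<alpha>)\<^sup>2 dvd S k (p ^ \<alpha>)"
proof -
  define n where "n = p ^ \<alpha>"
  define T where "T = (\<Sum>i<n. int i ^ k)"
  obtain m where m: "k = Suc m" "even m"
    using assms(5) by (cases k) auto
  have "int n dvd int (\<Sum>i<n. i ^ m)"
    using prime_power_dvd_sum_powers[OF assms(1), of m \<alpha>] assms(6) m
    by (simp only: n_def int_dvd_int_iff diff_Suc_1 not_False_eq_True)
  \<comment> \<open>One factor \<open>n\<close> is explicit, the other comes from the sum.\<close>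
  then have sum_m: "(int n)\<^sup>2 dvd int k * int n * (\<Sum>i<n. int i ^ m)"
    by (simp add: power2_eq_square mult.assoc mult.left_commute)
  have n_k: "(int n)\<^sup>2 dvd int n ^ k"
    using assms(4) by (simp add: le_imp_power_dvd)
  \<comment> \<open>Expand around \<open>- int i\<close>: the sign survives in the odd power
    \<open>k\<close> and disappears in the even power \<open>m\<close>.\<close>
  have pair: "[int (n - i) ^ k = int k * int n * int i ^ m - int i ^ k] (mod (int n)\<^sup>2)"
    if "i < n" for i
    using power_add_cong_square[of "- int i" "int n" m] that m
    by (simp add: of_nat_diff algebra_simps)
  \<comment> \<open>The added term at \<open>0\<close> vanishes since \<open>k > 0\<close>, so
    \<open>S k n\<close> exceeds \<open>T\<close> exactly by the last term
    \<open>n ^ k\<close>.\<close>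
  have "(\<Sum>i=1..n. int i ^ k) = (\<Sum>i\<le>n. int i ^ k)"
    using assms(4) by (intro sum.mono_neutral_left) auto
  then have S_eq: "int (S k n) = T + int n ^ k"
    by (simp add: S_def T_def lessThan_Suc_atMost[symmetric])
  \<comment> \<open>The reflection sends \<open>{..<n}\<close> onto \<open>{1..n}\<close>, so no
    boundary term appears here.\<close>
  have rev: "(\<Sum>i<n. int (n - i) ^ k) = int (S k n)"
    unfolding S_def of_nat_sum of_nat_power
    by (rule sum.reindex_bij_witness[of _ "\<lambda>i. n - i" "\<lambda>i. n - i"]) auto
  have "[int (S k n) = (\<Sum>i<n. int k * int n * int i ^ m - int i ^ k)] (mod (int n)\<^sup>2)"
    unfolding rev[symmetric] by (intro cong_sum pair) simp
  then have "(int n)\<^sup>2 dvd int (S k n) - (int k * int n * (\<Sum>i<n. int i ^ m) - T)"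
    by (simp add: cong_iff_dvd_diff sum_subtractf sum_distrib_left T_def)
  \<comment> \<open>The sum over \<open>i ^ m\<close> cancels, leaving
    \<open>S k n + T + n ^ k\<close>, which is twice \<open>S k n\<close>.\<close>
  from dvd_add[OF dvd_add[OF this sum_m] n_k]
  have "(int n)\<^sup>2 dvd 2 * int (S k n)"
    by (simp add: S_eq algebra_simps)
  then have "int (n\<^sup>2) dvd int (2 * S k n)" by simp
  then have "n\<^sup>2 dvd 2 * S k n" by (simp only: int_dvd_int_iff)
  moreover have "coprime (n\<^sup>2) 2" using assms(2) by (simp add: n_def)
  ultimately show ?thesis
    using coprime_dvd_mult_right_iff n_def by blast
qed

end
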